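(* Let $m,\ell$ be coprime integers with $\ell>m$ and $\ell\neq -m$, let $c_1,c_2$ be nonzero real numbers, and consider the plane curve $f(t)=c_1e^{itm}+c_2e^{it\ell}$, $t\in\mathbb{R}$. Then the curve $f$ has local singular points if and only if $$(mc_1)^2=(\ell c_2)^2 .$$ All the corresponding local singular points are return points of the first kind.
   Context: Write $f(t)=\phi(t)+i\psi(t)$ with $\phi,\psi$ real-valued; the curve is $x=\phi(t)$, $y=\psi(t)$ in the plane $\mathbb{R}^2\cong\mathbb{C}$. Local singular points of the curve are the points (parameter values $t$) where $\dot\phi(t)=\dot\psi(t)=0$. A local singular point $t_0$ is a return point of the first kind if: (I) both branches ($t>t_0$ and $t<t_0$) of the curve $w=f(t)$ have a common tangent line at the singular point $t_0$; (II) for small $t-t_0$ both branches of the curve are located on one side of the common normal; (III) for small $t-t_0$ the two branches of the curve are located on different sides of the common tangent line. *)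

theory Defs
  imports "HOL-Analysis.Analysis"
begin

definition local_singular_point :: "(real \<Rightarrow> complex) \<Rightarrow> real \<Rightarrow> bool" where
  "local_singular_point f t0 \<longleftrightarrow>
     ((\<lambda>t. Re (f t)) has_real_derivative 0) (at t0) \<and>
     ((\<lambda>t. Im (f t)) has_real_derivative 0) (at t0)"

definition line_through :: "complex \<Rightarrow> complex \<Rightarrow> complex set" where
  "line_through p v = {p + s *\<^sub>R v | s::real. True}"

text \<open>For \<open>n \<noteq> 0\<close> this is the open half-plane bounded by the line through \<open>p\<close> orthogonal to
  \<open>n\<close>, on the side into which \<open>n\<close> points; the other side is \<open>line_side p (- n)\<close>.\<close>

definition line_side :: "complex \<Rightarrow> complex \<Rightarrow> complex set" where
  "line_side p n = {z. (z - p) \<bullet> n > 0}"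

text \<open>The filter \<open>F\<close> selects the branch: \<open>at_right t0\<close> for \<open>t > t0\<close> and \<open>at_left t0\<close> for
  \<open>t < t0\<close>. The tangent line is spanned by the limit of the unit secant vectors; as
  \<open>sgn 0 = 0\<close>, a limit of norm 1 forces \<open>f t \<noteq> f t0\<close> near \<open>t0\<close> on that branch.\<close>

definition branch_tangent_line ::
    "(real \<Rightarrow> complex) \<Rightarrow> real \<Rightarrow> real filter \<Rightarrow> complex set \<Rightarrow> bool" where
  "branch_tangent_line f t0 F L \<longleftrightarrow>
     (\<exists>v. norm v = 1 \<and> ((\<lambda>t. sgn (f t - f t0)) \<longlongrightarrow> v) F \<and> L = line_through (f t0) v)"

text \<open>With \<open>v\<close> a unit vector spanning the common tangent, \<open>\<i> * v\<close> spans the common normal. So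
  the sides of the normal are the half-planes towards \<open>v\<close> and \<open>- v\<close>, and the sides of the
  tangent those towards \<open>\<i> * v\<close> and \<open>- (\<i> * v)\<close>.\<close>

definition return_point_first_kind :: "(real \<Rightarrow> complex) \<Rightarrow> real \<Rightarrow> bool" where
  "return_point_first_kind f t0 \<longleftrightarrow>
     local_singular_point f t0 \<and>
     (\<exists>v. norm v = 1 \<and>
        (branch_tangent_line f t0 (at_right t0) (line_through (f t0) v) \<and>
         branch_tangent_line f t0 (at_left t0) (line_through (f t0) v)) \<and>
        (\<exists>u \<in> {v, - v}. \<forall>\<^sub>F t in at t0. f t \<in> line_side (f t0) u) \<and>
        (\<exists>n \<in> {\<i> * v, - (\<i> * v)}.
           (\<forall>\<^sub>F t in at_right t0. f t \<in> line_side (f t0) n) \<and>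
           (\<forall>\<^sub>F t in at_left t0. f t \<in> line_side (f t0) (- n))))"

end

theory Submission
  imports Defs "HOL-Real_Asymp.Real_Asymp"
begin

text \<open>
  Up to the factor \<open>\<i>\<close>, the velocity of the curve is \<open>m c\<^sub>1 e\<^bsup>imt\<^esup> + l c\<^sub>2 e\<^bsup>ilt\<^esup>\<close>. It can vanish only if
  the two summands have the same modulus. Conversely, if the moduli agree, the
  velocity vanishes as soon as the relative phase \<open>(l - m) t\<close> is \<open>0\<close> or \<open>\<pi>\<close>, according to whether
  \<open>m c\<^sub>1\<close> and \<open>l c\<^sub>2\<close> have opposite or equal signs (\<open>two_frequency_singular_exists\<close>).

  At a singular parameter \<open>t\<^sub>0\<close>, equal moduli force \<open>m\<close> and \<open>l\<close> to be nonzero, since they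
  differ. Put \<open>A = c\<^sub>1 e\<^bsup>imt\<^sub>0\<^esup>\<close>. The vanishing of the velocity gives
  \<open>c\<^sub>2 e\<^bsup>ilt\<^sub>0\<^esup> = - (m / l) A\<close>, hence
  \<open>f (t\<^sub>0 + s) - f t\<^sub>0 = A (e\<^bsup>ims\<^esup> - 1 - (m / l) (e\<^bsup>ils\<^esup> - 1))\<close>. The linear terms of the bracket cancel, and
  its real and imaginary parts start with \<open>m (l - m) / 2 s\<^sup>2\<close> and
  \<open>m (l\<^sup>2 - m\<^sup>2) / 6 s\<^sup>3\<close>. As \<open>m \<noteq> 0\<close> and \<open>l \<noteq> \<plusminus> m\<close>, neither coefficient is zero, so the curve looks like the
  semicubical parabola \<open>(s\<^sup>2, s\<^sup>3)\<close> near \<open>t\<^sub>0\<close>, and this order of contact with the line through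
  \<open>f t\<^sub>0\<close> in direction \<open>A\<close> makes \<open>t\<^sub>0\<close> a return point of the first kind
  (\<open>return_point_first_kind_of_cusp_order\<close>).
\<close>

section \<open>Cusps of order (2,3)\<close>

text \<open>The component along \<open>v\<close> is even to leading order, so both branches leave in direction \<open>v\<close>,
  on the same side of the normal. The component along \<open>\<i> * v\<close> is odd to leading order, so
  the branches are on opposite sides of the tangent.\<close>

lemma return_point_first_kind_of_cusp_order:
  fixes f :: "real \<Rightarrow> complex" and v :: complex
  assumes singular: "local_singular_point f t0"
    and v: "norm v = 1"
    and a: "((\<lambda>t. ((f t - f t0) \<bullet> v) / (t - t0)^2) \<longlongrightarrow> a) (at t0)" "a > 0"
    and b: "((\<lambda>t. ((f t - f t0) \<bullet> (\<i> * v)) / (t - t0)^3) \<longlongrightarrow> b) (at t0)" "b \<noteq> 0"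
  shows "return_point_first_kind f t0"
proof -
  define w where "w t = (f t - f t0) /\<^sub>R (t - t0)^2" for t
  have off: "\<forall>\<^sub>F t in at t0. t \<noteq> t0"
    by (rule eventually_neq_at_within)
  have frame: "z = (z \<bullet> v) *\<^sub>R v + (z \<bullet> (\<i> * v)) *\<^sub>R (\<i> * v)" for z
  proof -
    have "Re v * Re v + Im v * Im v = 1"
      using v by (simp add: cmod_def power2_eq_square)
    then have "v * cnj v = 1"
      by (simp add: complex_eq_iff)
    moreover have "complex_of_real (z \<bullet> v) + \<i> * of_real (z \<bullet> (\<i> * v)) = z * cnj v"
      by (simp add: complex_eq_iff inner_complex_def algebra_simps)
    moreover have "(z \<bullet> v) *\<^sub>R v + (z \<bullet> (\<i> * v)) *\<^sub>R (\<i> * v)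
        = (of_real (z \<bullet> v) + \<i> * of_real (z \<bullet> (\<i> * v))) * v"
      by (simp add: scaleR_conv_of_real algebra_simps)
    ultimately show ?thesis
      by (simp add: mult.assoc mult.commute)
  qed
  have along: "((\<lambda>t. w t \<bullet> v) \<longlongrightarrow> a) (at t0)"
    using a(1) by (simp add: w_def divide_inverse mult.commute)
  have "((\<lambda>t. (t - t0) * (((f t - f t0) \<bullet> (\<i> * v)) / (t - t0)^3)) \<longlongrightarrow> (t0 - t0) * b) (at t0)"
    by (intro tendsto_intros b(1))
  moreover have "\<forall>\<^sub>F t in at t0. (t - t0) * (((f t - f t0) \<bullet> (\<i> * v)) / (t - t0)^3) = w t \<bullet> (\<i> * v)"
    using off by eventually_elim (simp add: w_def power2_eq_square power3_eq_cube divide_simps)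
  ultimately have across: "((\<lambda>t. w t \<bullet> (\<i> * v)) \<longlongrightarrow> 0) (at t0)"
    by (simp add: tendsto_cong)
  have "((\<lambda>t. (w t \<bullet> v) *\<^sub>R v + (w t \<bullet> (\<i> * v)) *\<^sub>R (\<i> * v)) \<longlongrightarrow> a *\<^sub>R v + 0 *\<^sub>R (\<i> * v)) (at t0)"
    by (intro tendsto_intros along across)
  then have "(w \<longlongrightarrow> a *\<^sub>R v) (at t0)"
    by (simp flip: frame)
  then have "((\<lambda>t. sgn (w t)) \<longlongrightarrow> sgn (a *\<^sub>R v)) (at t0)"
    using v a(2) by (intro tendsto_sgn) auto
  moreover have "sgn (a *\<^sub>R v) = v"
    using v a(2) by (simp add: sgn_scaleR) (simp add: sgn_div_norm)
  moreover have "\<forall>\<^sub>F t in at t0. sgn (w t) = sgn (f t - f t0)"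
    using off by eventually_elim (simp add: w_def sgn_scaleR sgn_if)
  ultimately have lim: "((\<lambda>t. sgn (f t - f t0)) \<longlongrightarrow> v) (at t0)"
    by (simp add: tendsto_cong)
  have tangent: "branch_tangent_line f t0 F (line_through (f t0) v)" if "F \<le> at t0" for F
    unfolding branch_tangent_line_def using v lim that tendsto_mono by blast
  have same_side: "\<forall>\<^sub>F t in at t0. f t \<in> line_side (f t0) v"
    using order_tendstoD(1)[OF a] off
    by eventually_elim (auto simp: line_side_def zero_less_divide_iff)
  define n where "n = sgn b *\<^sub>R (\<i> * v)"
  have n: "n \<in> {\<i> * v, - (\<i> * v)}"
    using b(2) by (auto simp: n_def sgn_if)
  have "((\<lambda>t. sgn b * (((f t - f t0) \<bullet> (\<i> * v)) / (t - t0)^3)) \<longlongrightarrow> sgn b * b) (at t0)"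
    by (intro tendsto_intros b(1))
  moreover have "sgn b * b > 0"
    using b(2) by (simp add: sgn_if)
  ultimately have "\<forall>\<^sub>F t in at t0. sgn b * (((f t - f t0) \<bullet> (\<i> * v)) / (t - t0)^3) > 0"
    by (rule order_tendstoD)
  then have cubic: "\<forall>\<^sub>F t in at t0. ((f t - f t0) \<bullet> n) / (t - t0)^3 > 0"
    by (simp add: n_def)
  have right: "\<forall>\<^sub>F t in at_right t0. f t \<in> line_side (f t0) n"
  proof -
    have "\<forall>\<^sub>F t in at_right t0. ((f t - f t0) \<bullet> n) / (t - t0)^3 > 0"
      using cubic by (rule filter_leD[OF at_le, rotated]) simp
    then show ?thesis
      using eventually_at_right_less[of t0]
      by eventually_elim (auto simp: line_side_def zero_less_divide_iff zero_less_power)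
  qed
  have left: "\<forall>\<^sub>F t in at_left t0. f t \<in> line_side (f t0) (- n)"
  proof -
    have "\<forall>\<^sub>F t in at_left t0. ((f t - f t0) \<bullet> n) / (t - t0)^3 > 0"
      using cubic by (rule filter_leD[OF at_le, rotated]) simp
    moreover have "\<forall>\<^sub>F t in at_left t0. t < t0"
      by (simp add: eventually_at_filter)
    ultimately show ?thesis
      by eventually_elim (auto simp: line_side_def zero_less_divide_iff zero_less_power_eq)
  qed
  show ?thesis
    unfolding return_point_first_kind_def
    using singular v tangent[OF at_le[OF subset_UNIV]] same_side n left right by blast
qed

section \<open>Expansion at a zero of the velocity\<close>

lemma cos_scaled_minus_one_quadratic:
  fixes k :: real
  shows "((\<lambda>s. (cos (k * s) - 1) / s^2) \<longlongrightarrow> - (k^2 / 2)) (at 0)"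
proof (cases "k = 0")
  case False
  have "((\<lambda>x::real. (cos x - 1) / x^2) \<longlongrightarrow> - (1/2)) (at 0)"
    by real_asymp
  moreover have "filterlim (\<lambda>s. k * s) (at 0) (at 0)"
    using False by (auto simp: filterlim_at eventually_at_filter intro!: tendsto_eq_intros)
  ultimately have "((\<lambda>s. (cos (k * s) - 1) / (k * s)^2) \<longlongrightarrow> - (1/2)) (at 0)"
    by (rule filterlim_compose)
  from tendsto_mult_left[OF this, of "k^2"] show ?thesis
    using False by (simp add: power_mult_distrib)
qed simp

lemma sin_scaled_minus_linear_cubic:
  fixes k :: real
  shows "((\<lambda>s. (sin (k * s) - k * s) / s^3) \<longlongrightarrow> - (k^3 / 6)) (at 0)"
proof (cases "k = 0")
  case False
  have "((\<lambda>x::real. (sin x - x) / x^3) \<longlongrightarrow> - (1/6)) (at 0)"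
    by real_asymp
  moreover have "filterlim (\<lambda>s. k * s) (at 0) (at 0)"
    using False by (auto simp: filterlim_at eventually_at_filter intro!: tendsto_eq_intros)
  ultimately have "((\<lambda>s. (sin (k * s) - k * s) / (k * s)^3) \<longlongrightarrow> - (1/6)) (at 0)"
    by (rule filterlim_compose)
  from tendsto_mult_left[OF this, of "k^3"] show ?thesis
    using False by (simp add: power_mult_distrib)
qed simp

lemma two_frequency_Re_quadratic:
  fixes m l :: real
  assumes "l \<noteq> 0"
  shows "((\<lambda>s. Re (cis (m * s) - 1 - of_real (m / l) * (cis (l * s) - 1)) / s^2)
           \<longlongrightarrow> m * (l - m) / 2) (at 0)"
proof -
  have "((\<lambda>s. (cos (m * s) - 1) / s^2 - m / l * ((cos (l * s) - 1) / s^2))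
           \<longlongrightarrow> - (m^2 / 2) - m / l * (- (l^2 / 2))) (at 0)"
    by (intro tendsto_intros cos_scaled_minus_one_quadratic)
  moreover have "- (m^2 / 2) - m / l * (- (l^2 / 2)) = m * (l - m) / 2"
    using assms by (simp add: field_simps power2_eq_square)
  moreover have "(cos (m * s) - 1) / s^2 - m / l * ((cos (l * s) - 1) / s^2)
      = Re (cis (m * s) - 1 - of_real (m / l) * (cis (l * s) - 1)) / s^2" for s
    by (simp add: diff_divide_distrib right_diff_distrib)
  ultimately show ?thesis
    by (simp only:)
qed

text \<open>The linear terms \<open>m s\<close> and \<open>(m / l) l s\<close> cancel, so each sine may be
  replaced by its deviation from its tangent at \<open>0\<close>.\<close>

lemma two_frequency_Im_cubic:
  fixes m l :: real
  assumes "l \<noteq> 0"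
  shows "((\<lambda>s. Im (cis (m * s) - 1 - of_real (m / l) * (cis (l * s) - 1)) / s^3)
           \<longlongrightarrow> m * (l^2 - m^2) / 6) (at 0)"
proof -
  have "((\<lambda>s. (sin (m * s) - m * s) / s^3 - m / l * ((sin (l * s) - l * s) / s^3))
           \<longlongrightarrow> - (m^3 / 6) - m / l * (- (l^3 / 6))) (at 0)"
    by (intro tendsto_intros sin_scaled_minus_linear_cubic)
  moreover have "- (m^3 / 6) - m / l * (- (l^3 / 6)) = m * (l^2 - m^2) / 6"
    using assms by (simp add: field_simps power2_eq_square power3_eq_cube)
  moreover have "(sin (m * s) - m * s) / s^3 - m / l * ((sin (l * s) - l * s) / s^3)
      = Im (cis (m * s) - 1 - of_real (m / l) * (cis (l * s) - 1)) / s^3" for s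
    using assms by (cases "s = 0") (simp_all add: field_simps)
  ultimately show ?thesis
    by (simp only:)
qed

section \<open>Superposition of two circular motions\<close>

lemma two_frequency_singular_iff:
  fixes m l c1 c2 :: real
  shows "local_singular_point (\<lambda>t. c1 * cis (m * t) + c2 * cis (l * t)) t \<longleftrightarrow>
           of_real (m * c1) * cis (m * t) + of_real (l * c2) * cis (l * t) = 0"
proof -
  have re: "((\<lambda>t. c1 * cos (m * t) + c2 * cos (l * t)) has_real_derivative
      - (m * c1 * sin (m * t) + l * c2 * sin (l * t))) (at t)"
    by (auto intro!: derivative_eq_intros)
  have im: "((\<lambda>t. c1 * sin (m * t) + c2 * sin (l * t)) has_real_derivative
      m * c1 * cos (m * t) + l * c2 * cos (l * t)) (at t)"
    by (auto intro!: derivative_eq_intros)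
  have "local_singular_point (\<lambda>t. c1 * cis (m * t) + c2 * cis (l * t)) t \<longleftrightarrow>
      - (m * c1 * sin (m * t) + l * c2 * sin (l * t)) = 0 \<and>
      m * c1 * cos (m * t) + l * c2 * cos (l * t) = 0"
    using re im unfolding local_singular_point_def by (auto dest: DERIV_unique)
  then show ?thesis
    by (auto simp: complex_eq_iff)
qed

lemma two_frequency_singular_moduli:
  fixes m l c1 c2 :: real
  assumes "local_singular_point (\<lambda>t. c1 * cis (m * t) + c2 * cis (l * t)) t"
  shows "(m * c1)\<^sup>2 = (l * c2)\<^sup>2"
proof -
  have "of_real (m * c1) * cis (m * t) = - (of_real (l * c2) * cis (l * t))"
    using assms unfolding two_frequency_singular_iff by (simp add: eq_neg_iff_add_eq_0)
  then have "norm (of_real (m * c1) * cis (m * t)) = norm (of_real (l * c2) * cis (l * t))"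
    by simp
  then have "\<bar>m * c1\<bar> = \<bar>l * c2\<bar>"
    by (simp add: norm_mult)
  then show ?thesis
    by (simp add: abs_eq_iff power2_eq_iff)
qed

lemma two_frequency_singular_exists:
  fixes m l c1 c2 :: real
  assumes "(m * c1)\<^sup>2 = (l * c2)\<^sup>2" and "m \<noteq> l"
  shows "\<exists>t. local_singular_point (\<lambda>t. c1 * cis (m * t) + c2 * cis (l * t)) t"
proof -
  consider (opposite) "m * c1 = - (l * c2)" | (equal) "m * c1 = l * c2"
    using assms(1) by (auto simp: power2_eq_iff)
  then show ?thesis
  proof cases
    case opposite
    then have "of_real (m * c1) * cis (m * 0) + of_real (l * c2) * cis (l * 0) = (0::complex)"
      by (simp flip: of_real_mult of_real_add)
    then show ?thesis
      unfolding two_frequency_singular_iff by blast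
  next
    case equal
    define t where "t = pi / (l - m)"
    have "l * t = m * t + pi"
      using assms(2) by (simp add: t_def field_simps)
    then have "cis (l * t) = - cis (m * t)"
      by (simp add: complex_eq_iff)
    then have "of_real (m * c1) * cis (m * t) + of_real (l * c2) * cis (l * t) = 0"
      unfolding equal by simp
    then show ?thesis
      unfolding two_frequency_singular_iff by blast
  qed
qed

lemma two_frequency_singular_return_point:
  fixes m l c1 c2 :: real
  assumes singular: "local_singular_point (\<lambda>t. c1 * cis (m * t) + c2 * cis (l * t)) t0"
    and "m \<noteq> 0" "l \<noteq> 0" "l \<noteq> m" "l \<noteq> - m" "c1 \<noteq> 0"
  shows "return_point_first_kind (\<lambda>t. c1 * cis (m * t) + c2 * cis (l * t)) t0"
proof -
  define f where "f = (\<lambda>t. c1 * cis (m * t) + c2 * cis (l * t))"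
  define A where "A = c1 * cis (m * t0)"
  define g where "g s = cis (m * s) - 1 - of_real (m / l) * (cis (l * s) - 1)" for s
  define a where "a = m * (l - m) / 2"
  define b where "b = m * (l^2 - m^2) / 6"
  have "A \<noteq> 0"
    using \<open>c1 \<noteq> 0\<close> by (simp add: A_def)
  have "a \<noteq> 0"
    using assms by (simp add: a_def)
  have "b \<noteq> 0"
    using assms by (auto simp: b_def power2_eq_iff)
  have velocity: "of_real m * A + of_real l * (c2 * cis (l * t0)) = 0"
    using singular unfolding two_frequency_singular_iff by (simp add: A_def mult_ac)
  have B: "c2 * cis (l * t0) = - (of_real (m / l) * A)"
    using velocity \<open>l \<noteq> 0\<close> by (simp add: field_simps eq_neg_iff_add_eq_0 add.commute)
  have expansion: "f t - f t0 = A * g (t - t0)" for t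
  proof -
    have shift: "cis (k * t) = cis (k * t0) * cis (k * (t - t0))" for k
      by (simp add: cis_mult algebra_simps)
    have "f t - f t0 = A * (cis (m * (t - t0)) - 1) + c2 * cis (l * t0) * (cis (l * (t - t0)) - 1)"
      unfolding f_def A_def shift[of m] shift[of l] by (simp add: algebra_simps)
    then show ?thesis
      unfolding B g_def by (simp add: algebra_simps)
  qed
  \<comment> \<open>The tangent direction is \<open>A\<close> or \<open>- A\<close>, whichever the quadratic term points to.\<close>
  define v where "v = sgn a *\<^sub>R sgn A"
  have "norm v = 1"
    using \<open>a \<noteq> 0\<close> \<open>A \<noteq> 0\<close> by (simp add: v_def norm_sgn)
  have unit: "A * cnj (sgn A) = of_real (norm A)"
  proof -
    have "A * cnj (sgn A) = (A * cnj A) /\<^sub>R norm A"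
      by (simp add: sgn_div_norm)
    then show ?thesis
      using \<open>A \<noteq> 0\<close>
      by (simp add: complex_norm_square[symmetric] scaleR_conv_of_real power2_eq_square)
  qed
  have inner: "z \<bullet> u = Re (z * cnj u)" for z u :: complex
    by (simp add: inner_complex_def)
  have rotate: "A * z * cnj v = of_real (norm A * sgn a) * z" for z
  proof -
    have "A * z * cnj v = of_real (sgn a) * (A * cnj (sgn A)) * z"
      by (simp add: v_def scaleR_conv_of_real mult_ac)
    then show ?thesis
      unfolding unit by (simp add: mult_ac)
  qed
  have coords: "(A * z) \<bullet> v = norm A * sgn a * Re z"
      "(A * z) \<bullet> (\<i> * v) = norm A * sgn a * Im z" for z
  proof -
    show "(A * z) \<bullet> v = norm A * sgn a * Re z"
      unfolding inner rotate by simp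
    have "A * z * cnj (\<i> * v) = - \<i> * (A * z * cnj v)"
      by (simp add: mult_ac)
    also have "\<dots> = - \<i> * (of_real (norm A * sgn a) * z)"
      unfolding rotate ..
    finally have turned: "A * z * cnj (\<i> * v) = - \<i> * (of_real (norm A * sgn a) * z)" .
    show "(A * z) \<bullet> (\<i> * v) = norm A * sgn a * Im z"
      unfolding inner turned by simp
  qed
  have to_0: "filterlim (\<lambda>t. t - t0) (at 0) (at t0)"
    by (auto simp: filterlim_at eventually_at_filter intro!: tendsto_eq_intros)
  have "((\<lambda>t. Re (g (t - t0)) / (t - t0)^2) \<longlongrightarrow> a) (at t0)"
    using filterlim_compose[OF two_frequency_Re_quadratic[OF \<open>l \<noteq> 0\<close>] to_0]
    unfolding g_def a_def .
  from tendsto_mult_left[OF this, of "norm A * sgn a"]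
  have along: "((\<lambda>t. ((f t - f t0) \<bullet> v) / (t - t0)^2) \<longlongrightarrow> norm A * sgn a * a) (at t0)"
    by (simp add: expansion coords)
  have "((\<lambda>t. Im (g (t - t0)) / (t - t0)^3) \<longlongrightarrow> b) (at t0)"
    using filterlim_compose[OF two_frequency_Im_cubic[OF \<open>l \<noteq> 0\<close>] to_0]
    unfolding g_def b_def .
  from tendsto_mult_left[OF this, of "norm A * sgn a"]
  have across: "((\<lambda>t. ((f t - f t0) \<bullet> (\<i> * v)) / (t - t0)^3) \<longlongrightarrow> norm A * sgn a * b) (at t0)"
    by (simp add: expansion coords)
  have "return_point_first_kind f t0"
  proof (rule return_point_first_kind_of_cusp_order)
    show "local_singular_point f t0"
      using singular by (simp add: f_def)
    show "norm A * sgn a * a > 0"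
      using \<open>a \<noteq> 0\<close> \<open>A \<noteq> 0\<close> by (auto simp: sgn_if mult_less_0_iff)
    show "norm A * sgn a * b \<noteq> 0"
      using \<open>a \<noteq> 0\<close> \<open>A \<noteq> 0\<close> \<open>b \<noteq> 0\<close> by (simp add: sgn_if)
  qed (fact \<open>norm v = 1\<close> along across)+
  then show ?thesis
    by (simp add: f_def)
qed

theorem proposition1p1:
  fixes m l :: int and c1 c2 :: real and f :: "real \<Rightarrow> complex"
  assumes "coprime m l" and "l > m" and "l \<noteq> - m"
    and "c1 \<noteq> 0" and "c2 \<noteq> 0"
    and "\<And>t. f t = of_real c1 * exp (\<i> * of_real t * of_int m)
                   + of_real c2 * exp (\<i> * of_real t * of_int l)"
  shows "((\<exists>t. local_singular_point f t) \<longleftrightarrow>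
            (of_int m * c1)\<^sup>2 = (of_int l * c2)\<^sup>2) \<and>
         (\<forall>t. local_singular_point f t \<longrightarrow> return_point_first_kind f t)"
proof -
  have f: "f = (\<lambda>t. c1 * cis (of_int m * t) + c2 * cis (of_int l * t))"
    using assms(6) by (auto simp: cis_conv_exp mult_ac)
  have ne: "real_of_int l \<noteq> of_int m" "real_of_int l \<noteq> - of_int m"
    using assms(2,3) by linarith+
  have "return_point_first_kind f t" if "local_singular_point f t" for t
  proof -
    have moduli: "(of_int m * c1)\<^sup>2 = (of_int l * c2)\<^sup>2"
      using that two_frequency_singular_moduli unfolding f by blast
    \<comment> \<open>Equal moduli make both frequencies vanish as soon as one does, which \<open>l > m\<close> excludes.\<close>
    then have "real_of_int m \<noteq> 0" "real_of_int l \<noteq> 0"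
      using assms(2,4,5) by auto
    then show ?thesis
      using that two_frequency_singular_return_point ne assms(4) unfolding f by blast
  qed
  moreover have "(\<exists>t. local_singular_point f t) \<longleftrightarrow> (of_int m * c1)\<^sup>2 = (of_int l * c2)\<^sup>2"
    using two_frequency_singular_moduli two_frequency_singular_exists ne(1) unfolding f
    by metis
  ultimately show ?thesis
    by blast
qed

end
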